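(* Let $(X,\triangleright)$ be a kei, and let $(S,\triangleright)$ be a subkei. Let $C\subseteq X$ span a component of the edge-coloured multigraph $G_S$ (or equivalently of the reduced simple graph $G_S^0$), and suppose that $G_S[C]$ has diameter $d$. Then $|C|\geqslant 2^d$, and further there exists some $k\in S$ such that there are at least $2^{d-1}$ edges of colour $k$ in $G_S[C]$.
   Context: A kei is a pair $(X,\triangleright)$ with $X$ a non-empty set and $\triangleright:X\times X\to X$ a binary operation such that: for each $y\in X$ the map $x\mapsto x\triangleright y$ is a bijection on $X$; $(x\triangleright y)\triangleright z=(x\triangleright z)\triangleright(y\triangleright z)$ for all $x,y,z\in X$; $x\triangleright x=x$ for all $x\in X$; and $(x\triangleright y)\triangleright y=x$ for all $x,y\in X$. For $y\in X$ write $f_y:X\to X$ for the involution $(x)f_y=x\triangleright y$ (maps act on the right). A subkei of $(X,\triangleright)$ is a kei $(S,\triangleright)$ where $S\subseteq X$ and the operation is the restriction of $\triangleright$ to $S\times S$; thus a (non-empty) subset $S\subseteq X$ forms a subkei if and only if $(z)f_y\in S$ for all $y,z\in S$. For $S\subseteq X$, $G_S$ is the loopless edge-coloured multigraph with vertex set $X$ (the whole of $X$) and colour set $S$, in which, for each $y\in S$, there is an edge of colour $y$ between $u$ and $v$ if and only if $u\neq v$ and $(u)f_y=v$ (well defined since $f_y$ is an involution). Edges of different colours between the same two vertices are different edges. The reduced graph $G_S^0$ is the simple graph on $X$ in which $uv$ is an edge if and only if there is at least one edge between $u$ and $v$ in $G_S$. $G_S[C]$ denotes the subgraph of $G_S$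 induced on $C$. Distance and diameter refer to the usual graph distance, ignoring colours and multiplicities.
   Formalization: The claim that some colour k in S has at least 2^{d-1} edges is stated only for d ≥ 1; for d = 0 the component is a single vertex of a loopless graph, has no edges, and the claim is false. *)

theory Defs
  imports "Graph_Theory.Graph_Theory"
begin

section \<open>Keis\<close>

locale kei =
  fixes X :: "'a set" and oper :: "'a \<Rightarrow> 'a \<Rightarrow> 'a"  (infixl \<open>\<triangleright>\<close> 70)
  assumes nonempty: "X \<noteq> {}"
    and closed: "\<And>x y. x \<in> X \<Longrightarrow> y \<in> X \<Longrightarrow> x \<triangleright> y \<in> X"
    and bij: "\<And>y. y \<in> X \<Longrightarrow> bij_betw (\<lambda>x. x \<triangleright> y) X X"
    and self_distrib: "\<And>x y z. x \<in> X \<Longrightarrow> y \<in> X \<Longrightarrow> z \<in> X \<Longrightarrow>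
          (x \<triangleright> y) \<triangleright> z = (x \<triangleright> z) \<triangleright> (y \<triangleright> z)"
    and idem: "\<And>x. x \<in> X \<Longrightarrow> x \<triangleright> x = x"
    and involutory: "\<And>x y. x \<in> X \<Longrightarrow> y \<in> X \<Longrightarrow> (x \<triangleright> y) \<triangleright> y = x"

definition subkei :: "'a set \<Rightarrow> 'a set \<Rightarrow> ('a \<Rightarrow> 'a \<Rightarrow> 'a) \<Rightarrow> bool" where
  "subkei S X oper \<longleftrightarrow> S \<subseteq> X \<and> kei S oper"

section \<open>Edge-coloured multigraphs\<close>

text \<open>
  An undirected edge of colour \<open>k\<close> between \<open>u\<close> and \<open>v\<close> is represented by the two opposite
  arcs \<open>(k, u, v)\<close> and \<open>(k, v, u)\<close>; in particular arcs of different colours with the same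
  ends are different. For \<open>S \<subseteq> X\<close> in a kei the arc set below is closed under reversal,
  because each \<open>\<lambda>u. oper u y\<close> is an involution.
\<close>

definition kei_graph :: "'a set \<Rightarrow> ('a \<Rightarrow> 'a \<Rightarrow> 'a) \<Rightarrow> 'a set \<Rightarrow> ('a, 'a \<times> 'a \<times> 'a) pre_digraph" where
  "kei_graph X oper S =
     \<lparr> verts = X,
       arcs = {(y, u, v). y \<in> S \<and> u \<in> X \<and> v \<in> X \<and> u \<noteq> v \<and> oper u y = v},
       tail = (\<lambda>(y, u, v). u),
       head = (\<lambda>(y, u, v). v) \<rparr>"

text \<open>Unordered pairs, so that the two arcs representing an edge are counted once.\<close>

definition edges_of_colour :: "('v, 'c \<times> 'v \<times> 'v) pre_digraph \<Rightarrow> 'c \<Rightarrow> 'v set set" where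
  "edges_of_colour G k = {{u, v} | u v. (k, u, v) \<in> arcs G}"

text \<open>
  A component is a maximal connected subgraph. It is automatically an induced subgraph, so it
  is determined by its vertex set. The predicate \<^const>\<open>Digraph_Component.connected\<close> only
  looks at \<^const>\<open>mk_symmetric\<close>, the underlying simple graph, so colours and multiplicities
  are irrelevant.
\<close>

definition spans_component :: "('v, 'e) pre_digraph \<Rightarrow> 'v set \<Rightarrow> bool" where
  "spans_component G C \<longleftrightarrow> pre_digraph.max_subgraph G Digraph_Component.connected (G \<restriction> C)"

text \<open>Every arc has weight one, so \<open>\<mu>\<close> is the length of a shortest directed walk (\<open>\<infinity>\<close> if there is
  none), which on a symmetric digraph is the usual graph distance.\<close>

definition diameter :: "('v, 'e) pre_digraph \<Rightarrow> ereal" where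
  "diameter G = (SUP u\<in>verts G. SUP v\<in>verts G. wf_digraph.\<mu> G (\<lambda>_. 1) u v)"


section \<open>Basic properties\<close>

lemma wf_kei_graph: "wf_digraph (kei_graph X oper S)"
  by unfold_locales (auto simp: kei_graph_def)

lemma symmetric_kei_graph:
  assumes "kei X oper" "S \<subseteq> X"
  shows "symmetric (kei_graph X oper S \<restriction> C)"
proof -
  have "(v, u) \<in> arcs_ends (kei_graph X oper S \<restriction> C)"
    if uv: "(u, v) \<in> arcs_ends (kei_graph X oper S \<restriction> C)" for u v
  proof -
    from uv obtain y where y: "y \<in> S" "u \<in> X" "v \<in> X" "u \<noteq> v" "oper u y = v" "u \<in> C" "v \<in> C"
      by (auto simp: arcs_ends_conv kei_graph_def)
    then have "oper v y = u"
      using kei.involutory[OF assms(1), of u y] assms(2) by auto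
    with y show ?thesis
      by (force simp: arcs_ends_conv kei_graph_def)
  qed
  then show ?thesis by (auto simp: symmetric_def sym_def)
qed

lemma spans_component_iff:
  assumes "wf_digraph G"
  shows "spans_component G C \<longleftrightarrow> C \<subseteq> verts G \<and> Digraph_Component.connected (G \<restriction> C) \<and>
    (\<forall>D. C \<subset> D \<and> D \<subseteq> verts G \<longrightarrow> \<not> Digraph_Component.connected (G \<restriction> D))"
    (is "?L \<longleftrightarrow> ?R")
proof
  interpret wf_digraph G by fact
  assume L: ?L
  have sub: "subgraph (G \<restriction> C) G" and con: "Digraph_Component.connected (G \<restriction> C)"
    using L by (auto simp: spans_component_def max_subgraph_def)
  have "\<not> Digraph_Component.connected (G \<restriction> D)" if D: "C \<subset> D" "D \<subseteq> verts G" for D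
  proof -
    have wfs: "wf_digraph (G \<restriction> C)" "wf_digraph (G \<restriction> D)" by (unfold_locales; auto)+
    have "subgraph (G \<restriction> C) (G \<restriction> D)" "subgraph (G \<restriction> D) G" "G \<restriction> D \<noteq> G \<restriction> C"
      using D wfs wf_digraph_axioms
      by (auto simp: subgraph_def compatible_def induce_subgraph_def)
    then show ?thesis using L by (auto simp: spans_component_def max_subgraph_def)
  qed
  moreover have "C \<subseteq> verts G" using sub by (auto simp: subgraph_def)
  ultimately show ?R using con by blast
next
  interpret wf_digraph G by fact
  assume R: ?R
  have wfC: "wf_digraph (G \<restriction> C)" by unfold_locales auto
  have "\<not> Digraph_Component.connected H"
    if H: "H \<noteq> G \<restriction> C" "subgraph (G \<restriction> C) H" "subgraph H G" for H
  proof
    assume conH: "Digraph_Component.connected H"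
    have vH: "C \<subseteq> verts H" "verts H \<subseteq> verts G" using H by (auto simp: subgraph_def)
    have aH: "arcs H \<subseteq> arcs (G \<restriction> verts H)"
      using H(3) by (auto simp: subgraph_def compatible_def dest: wf_digraph.tail_in_verts wf_digraph.head_in_verts)
    have wfH: "wf_digraph (G \<restriction> verts H)" by unfold_locales auto
    have "spanning H (G \<restriction> verts H)"
      using H(3) aH wfH by (auto simp: spanning_def subgraph_def compatible_def)
    then have con: "Digraph_Component.connected (G \<restriction> verts H)"
      using wf_digraph.connected_spanning_imp_connected[OF wfH] conH by blast
    have "verts H \<noteq> C"
    proof
      assume "verts H = C"
      then have "H = G \<restriction> C"
        using H(2,3) aH by (auto simp: subgraph_def compatible_def induce_subgraph_def intro!: pre_digraph.equality)
      with H(1) show False by simp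
    qed
    then show False using R con vH by blast
  qed
  moreover have "subgraph (G \<restriction> C) G"
    using R wfC wf_digraph_axioms by (auto simp: subgraph_def compatible_def)
  ultimately show ?L using R by (auto simp: spans_component_def max_subgraph_def)
qed

text \<open>The multigraph and its reduced simple graph have the same components.\<close>

lemma spans_component_mk_symmetric:
  assumes "wf_digraph G"
  shows "spans_component (with_proj (mk_symmetric G)) C \<longleftrightarrow> spans_component G C"
proof -
  interpret wf_digraph G by fact
  have "mk_symmetric (with_proj (mk_symmetric G) \<restriction> D) = mk_symmetric (G \<restriction> D)" for D
    by (auto simp: mk_symmetric_def induce_subgraph_def)
  then have "Digraph_Component.connected (with_proj (mk_symmetric G) \<restriction> D)
      \<longleftrightarrow> Digraph_Component.connected (G \<restriction> D)" for D
    by (simp add: connected_def)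
  moreover have "wf_digraph (with_proj (mk_symmetric G))"
    using wellformed_mk_symmetric by (simp add: wf_digraph_wp_iff)
  ultimately show ?thesis
    using assms by (simp add: spans_component_iff)
qed

end

theory Submission
  imports Defs
begin

text \<open>
  Take a shortest word \<open>y\<^sub>1 \<dots> y\<^sub>n\<close> over \<open>S\<close> leading from \<open>u\<close> to \<open>v\<close>. Self-distributivity says
  that a letter can be pushed to the right past \<open>y\<close> at the price of conjugating it by \<open>y\<close>. So the
  letters outside a given subword can all be collected behind it, and replacing the subword by a
  shorter word with the same effect on \<open>u\<close> would shorten the whole word: subwords of geodesic words
  are geodesic. If two of the \<open>2\<^sup>n\<close> subwords led to the same vertex, then after cancelling a common
  suffix there would be \<open>A\<close>, \<open>B\<close> and a letter \<open>y\<close> such that \<open>A y\<close> and \<open>B\<close> lead to the same vertex,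
  and so do \<open>B y\<close> and \<open>A\<close>; then \<open>|A| + 1 \<le> |B|\<close> and \<open>|B| + 1 \<le> |A|\<close>. Hence the \<open>2\<^sup>n\<close> endpoints are
  distinct, and the edges of colour \<open>y\<^sub>n\<close> match those of the subwords avoiding the last letter with
  the others.
\<close>

section \<open>Geodesic words\<close>

locale kei_with_subkei = kei X oper for X :: "'a set" and oper (infixl \<open>\<triangleright>\<close> 70) +
  fixes S :: "'a set"
  assumes subset: "S \<subseteq> X"
    and sub_closed: "\<And>x y. x \<in> S \<Longrightarrow> y \<in> S \<Longrightarrow> x \<triangleright> y \<in> S"
begin

text \<open>Words are used instead of walks because a word acts on every vertex and its letters can
  be conjugated and rearranged. A letter may fix the current vertex, so not every word traces a walk
  of the same length.\<close>

definition geodesic :: "'a \<Rightarrow> 'a list \<Rightarrow> bool" where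
  "geodesic u ys \<longleftrightarrow> (\<forall>zs\<in>lists S. foldl (\<triangleright>) u zs = foldl (\<triangleright>) u ys \<longrightarrow> length ys \<le> length zs)"

lemma foldl_closed: "u \<in> X \<Longrightarrow> ys \<in> lists S \<Longrightarrow> foldl (\<triangleright>) u ys \<in> X"
  by (induction ys arbitrary: u) (use closed subset in auto)

lemma oper_right_cancel: "\<lbrakk>x \<in> X; x' \<in> X; y \<in> X; x \<triangleright> y = x' \<triangleright> y\<rbrakk> \<Longrightarrow> x = x'"
  by (metis involutory)

text \<open>By self-distributivity, acting by \<open>y\<close> is an endomorphism: \<open>y\<close>
  moves from behind a word to its front, at the price of conjugating every letter.\<close>

lemma foldl_oper:
  assumes "u \<in> X" "hs \<in> lists S" "y \<in> S"
  shows "foldl (\<triangleright>) u hs \<triangleright> y = foldl (\<triangleright>) (u \<triangleright> y) (map (\<lambda>h. h \<triangleright> y) hs)"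
  using assms
proof (induction hs arbitrary: u)
  case (Cons h hs)
  then have "u \<in> X" "h \<in> X" "y \<in> X" using subset by auto
  then show ?case
    using Cons.IH[of "u \<triangleright> h"] Cons.prems by (simp add: closed self_distrib[of u h y])
qed simp

section \<open>Subwords of geodesic words\<close>

lemma nths_lists: "ys \<in> lists S \<Longrightarrow> nths ys A \<in> lists S"
  by (meson in_listsI in_lists_conv_set notin_set_nthsI)

lemma nths_snoc: "nths (ys @ [y]) A = nths ys A @ (if length ys \<in> A then [y] else [])"
  by (simp add: nths_append)

lemma nths_restrict: "nths ys (A \<inter> {..<length ys}) = nths ys A"
  unfolding nths_def by (intro arg_cong[of _ _ "map fst"] filter_cong) (auto dest!: set_zip_rightD)

text \<open>The index \<open>length ys\<close> is out of range for \<open>ys\<close> but is the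
  position of the last letter of \<open>ys @ [y]\<close>. With \<open>nths_snoc\<close>, inserting
  it into \<open>A\<close> therefore appends \<open>y\<close> to the subword.\<close>

lemma nths_insert_length: "nths ys (insert (length ys) A) = nths ys A"
  unfolding nths_def by (intro arg_cong[of _ _ "map fst"] filter_cong) (auto dest!: set_zip_rightD)

lemma foldl_collect_subword:
  assumes "u \<in> X" "ys \<in> lists S"
  obtains hs where "hs \<in> lists S" "length hs + length (nths ys A) = length ys"
    "foldl (\<triangleright>) u ys = foldl (\<triangleright>) (foldl (\<triangleright>) u (nths ys A)) hs"
  using assms(2)
proof (induction ys arbitrary: thesis rule: rev_induct)
  case (snoc y ys)
  from snoc.prems have y: "y \<in> S" "ys \<in> lists S" by auto
  from snoc.IH[OF _ y(2)] obtain hs where hs: "hs \<in> lists S"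
    "length hs + length (nths ys A) = length ys"
    "foldl (\<triangleright>) u ys = foldl (\<triangleright>) (foldl (\<triangleright>) u (nths ys A)) hs" by blast
  show ?case
  proof (cases "length ys \<in> A")
    case True
    have "foldl (\<triangleright>) u (nths ys A) \<in> X"
      using assms(1) y(2) by (intro foldl_closed nths_lists)
    \<comment> \<open>A selected \<open>y\<close> jumps in front of the letters collected so far.
      Their conjugates stay in \<open>S\<close> because \<open>S\<close> is a subkei, and their
      number is unchanged.\<close>
    moreover have "map (\<lambda>h. h \<triangleright> y) hs \<in> lists S"
      using hs(1) y(1) sub_closed by auto
    ultimately show ?thesis
      using True hs y by (intro snoc.prems(1)[of "map (\<lambda>h. h \<triangleright> y) hs"]) (simp_all add: nths_snoc foldl_oper)
  next
    case False
    then show ?thesis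
      using hs y by (intro snoc.prems(1)[of "hs @ [y]"]) (simp_all add: nths_snoc)
  qed
qed simp

lemma geodesic_nths:
  assumes "u \<in> X" "ys \<in> lists S" "geodesic u ys"
  shows "geodesic u (nths ys A)"
  unfolding geodesic_def
proof (intro ballI impI)
  fix zs assume zs: "zs \<in> lists S" "foldl (\<triangleright>) u zs = foldl (\<triangleright>) u (nths ys A)"
  obtain hs where hs: "hs \<in> lists S" "length hs + length (nths ys A) = length ys"
    "foldl (\<triangleright>) u ys = foldl (\<triangleright>) (foldl (\<triangleright>) u (nths ys A)) hs"
    using foldl_collect_subword[OF assms(1,2)] .
  have "foldl (\<triangleright>) u (zs @ hs) = foldl (\<triangleright>) u ys" using zs hs by simp
  moreover have "zs @ hs \<in> lists S" using zs hs by simp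
  ultimately have "length ys \<le> length (zs @ hs)"
    using assms(3) unfolding geodesic_def by blast
  with hs(2) show "length (nths ys A) \<le> length zs" by simp
qed

lemma geodesic_snocD:
  assumes "geodesic u (ys @ [y])" "y \<in> S"
  shows "geodesic u ys"
  unfolding geodesic_def
proof (intro ballI impI)
  fix zs assume "zs \<in> lists S" "foldl (\<triangleright>) u zs = foldl (\<triangleright>) u ys"
  then show "length ys \<le> length zs"
    using assms unfolding geodesic_def by (auto dest!: bspec[of _ _ "zs @ [y]"])
qed

lemma inj_on_subword_endpoints:
  assumes "u \<in> X" "ys \<in> lists S" "geodesic u ys"
  shows "inj_on (\<lambda>A. foldl (\<triangleright>) u (nths ys A)) (Pow {..<length ys})"
  using assms(2,3)
proof (induction ys rule: rev_induct)
  case (snoc y ys)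
  let ?e = "\<lambda>A. foldl (\<triangleright>) u (nths ys A)"
  let ?n = "length ys"
  from snoc.prems have y: "y \<in> S" "y \<in> X" "ys \<in> lists S" using subset by auto
  have IH: "inj_on ?e (Pow {..<?n})"
    using snoc.IH y geodesic_snocD snoc.prems(2) by blast
  have e: "?e A \<in> X" for A
    using assms(1) y(3) by (intro foldl_closed nths_lists)
  \<comment> \<open>The subword \<open>A\<close> followed by \<open>y\<close> is again a subword of
    \<open>ys @ [y]\<close>, hence geodesic, and the subword \<open>B\<close> competes with it. The
    extra letter makes the inequality strict.\<close>
  have le: "length (nths ys A) < length (nths ys B)" if "?e A \<triangleright> y = ?e B" for A B
  proof -
    have "geodesic u (nths (ys @ [y]) (insert ?n A))"
      by (intro geodesic_nths assms(1) snoc.prems)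
    then have "geodesic u (nths ys A @ [y])"
      by (simp add: nths_snoc nths_insert_length)
    moreover have "nths ys B \<in> lists S" using y(3) by (rule nths_lists)
    ultimately show ?thesis using that unfolding geodesic_def by fastforce
  qed
  have ne: "?e A \<triangleright> y \<noteq> ?e B" for A B
  proof
    assume eq: "?e A \<triangleright> y = ?e B"
    then have "?e B \<triangleright> y = ?e A" using e y by (metis involutory)
    with eq le show False by (meson less_asym)
  qed
  show ?case
  proof (rule inj_onI)
    fix A B assume AB: "A \<in> Pow {..<length (ys @ [y])}" "B \<in> Pow {..<length (ys @ [y])}"
      and eq: "foldl (\<triangleright>) u (nths (ys @ [y]) A) = foldl (\<triangleright>) u (nths (ys @ [y]) B)"
    \<comment> \<open>If only one of the two subwords used the last letter, its endpoints would
      contradict \<open>ne\<close>. So both use it or neither does, and it can be cancelled.\<close>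
    have mem: "?n \<in> A \<longleftrightarrow> ?n \<in> B"
      using eq ne[of A B] ne[of B A] by (auto simp: nths_snoc split: if_splits)
    then have "?e A = ?e B"
      using eq e y oper_right_cancel by (auto simp: nths_snoc split: if_splits)
    then have "?e (A \<inter> {..<?n}) = ?e (B \<inter> {..<?n})"
      by (simp only: nths_restrict)
    then have "A \<inter> {..<?n} = B \<inter> {..<?n}"
      using IH by (auto dest: inj_onD)
    with mem AB show "A = B" by (auto simp: less_Suc_eq set_eq_iff subset_iff)
  qed
qed simp

lemma ex_geodesic:
  assumes "zs \<in> lists S"
  obtains ys where "ys \<in> lists S" "foldl (\<triangleright>) u ys = foldl (\<triangleright>) u zs" "geodesic u ys"
proof -
  let ?P = "\<lambda>ys. ys \<in> lists S \<and> foldl (\<triangleright>) u ys = foldl (\<triangleright>) u zs"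
  obtain ys where "?P ys" "\<And>ys'. ?P ys' \<Longrightarrow> length ys \<le> length ys'"
    using ex_has_least_nat[of ?P zs length] assms by blast
  then show ?thesis by (intro that[of ys]) (auto simp: geodesic_def)
qed

section \<open>Components\<close>

abbreviation G where "G \<equiv> kei_graph X (\<triangleright>) S"

lemma arcs_induced: "(y, u, v) \<in> arcs (G \<restriction> C) \<longleftrightarrow>
    y \<in> S \<and> u \<in> X \<inter> C \<and> v \<in> X \<inter> C \<and> u \<noteq> v \<and> u \<triangleright> y = v"
  by (auto simp: kei_graph_def)

lemma kei_graph_sel [simp]: "verts G = X" "tail G (y, u, v) = u" "head G (y, u, v) = v"
  by (simp_all add: kei_graph_def)

lemma wf_induced: "wf_digraph (G \<restriction> C)"
  by unfold_locales (auto simp: kei_graph_def)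

text \<open>Otherwise adjoining the new neighbour to \<open>C\<close> would give a larger connected
  induced subgraph, against maximality.\<close>

lemma component_closed:
  assumes "spans_component G C" "u \<in> C" "y \<in> S"
  shows "u \<triangleright> y \<in> C"
proof (rule ccontr)
  let ?w = "u \<triangleright> y"
  let ?D = "insert ?w C"
  assume w: "?w \<notin> C"
  from assms(1) have C: "C \<subseteq> X" and con: "Digraph_Component.connected (G \<restriction> C)"
    and max: "\<And>D. C \<subset> D \<Longrightarrow> D \<subseteq> X \<Longrightarrow> \<not> Digraph_Component.connected (G \<restriction> D)"
    by (auto simp: spans_component_iff[OF wf_kei_graph])
  have wX: "?w \<in> X" using closed assms subset C by blast
  have symm: "symmetric (G \<restriction> D)" for D
    using symmetric_kei_graph[OF kei_axioms subset] .
  interpret D: wf_digraph "G \<restriction> ?D" by (rule wf_induced)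
  interpret C: wf_digraph "G \<restriction> C" by (rule wf_induced)
  have sub: "subgraph (G \<restriction> C) (G \<restriction> ?D)"
    by (auto simp: subgraph_def compatible_def C.wf_digraph_axioms D.wf_digraph_axioms)
  have reachC: "a \<rightarrow>\<^sup>*\<^bsub>G \<restriction> ?D\<^esub> b" if "a \<in> C" "b \<in> C" for a b
  proof -
    \<comment> \<open>\<open>connected\<close> refers to the symmetrised graph; since arcs come in
      opposite pairs, this is the same as directed reachability.\<close>
    have "a \<rightarrow>\<^sup>*\<^bsub>G \<restriction> C\<^esub> b"
      using con that C.reachable_mk_symmetric_eq[OF symm]
      by (auto simp: connected_def strongly_connected_def)
    then show ?thesis using sub by (rule pre_digraph.reachable_mono)
  qed
  have "(y, u, ?w) \<in> arcs (G \<restriction> ?D)"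
    using assms C wX w by (auto simp only: arcs_induced)
  then have "u \<rightarrow>\<^bsub>G \<restriction> ?D\<^esub> ?w"
    by (force simp: arcs_ends_conv)
  then have uw: "u \<rightarrow>\<^sup>*\<^bsub>G \<restriction> ?D\<^esub> ?w" by (rule D.reachable_adjI)
  then have wu: "?w \<rightarrow>\<^sup>*\<^bsub>G \<restriction> ?D\<^esub> u" by (rule symmetric_reachable[OF symm])
  have "a \<rightarrow>\<^sup>*\<^bsub>G \<restriction> ?D\<^esub> b" if "a \<in> ?D" "b \<in> ?D" for a b
  proof -
    have "a \<rightarrow>\<^sup>*\<^bsub>G \<restriction> ?D\<^esub> u" using that(1) wu reachC assms(2) by blast
    also have "u \<rightarrow>\<^sup>*\<^bsub>G \<restriction> ?D\<^esub> b" using that(2) uw reachC assms(2) by blast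
    finally show ?thesis .
  qed
  then have "Digraph_Component.connected (G \<restriction> ?D)"
    by (auto intro!: D.connectedI D.reachable_mk_symmetricI)
  with max[of ?D] w wX C show False by auto
qed

lemma component_foldl_closed:
  "\<lbrakk>spans_component G C; u \<in> C; ys \<in> lists S\<rbrakk> \<Longrightarrow> foldl (\<triangleright>) u ys \<in> C"
  by (induction ys arbitrary: u) (auto intro: component_closed)

section \<open>Translation between walks and words\<close>

lemma awalk_imp_word:
  assumes "pre_digraph.awalk (G \<restriction> C) u p v"
  obtains ys where "ys \<in> lists S" "foldl (\<triangleright>) u ys = v"
proof -
  interpret wf_digraph "G \<restriction> C" by (rule wf_induced)
  have "\<exists>ys\<in>lists S. foldl (\<triangleright>) u ys = v"
    using assms
  proof (induction p arbitrary: u)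
    case Nil
    then show ?case by (auto simp: awalk_Nil_iff intro: bexI[of _ "[]"])
  next
    case (Cons e p)
    obtain y a b where e: "e = (y, a, b)" by (cases e) auto
    with Cons.prems have *: "(y, a, b) \<in> arcs (G \<restriction> C)" "u = a" "awalk b p v"
      by (auto simp: awalk_Cons_iff)
    from Cons.IH[OF *(3)] obtain ys where "ys \<in> lists S" "foldl (\<triangleright>) b ys = v" by blast
    with * show ?case by (intro bexI[of _ "y # ys"]) (auto simp only: arcs_induced foldl.simps lists.intros)
  qed
  with that show ?thesis by blast
qed

text \<open>The walk may be shorter than the word because letters fixing the current vertex give no arc.\<close>

lemma word_imp_awalk:
  assumes "spans_component G C" "C \<subseteq> X" "u \<in> C" "ys \<in> lists S"
  obtains p where "pre_digraph.awalk (G \<restriction> C) u p (foldl (\<triangleright>) u ys)" "length p \<le> length ys"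
proof -
  interpret wf_digraph "G \<restriction> C" by (rule wf_induced)
  have "\<exists>p. awalk u p (foldl (\<triangleright>) u ys) \<and> length p \<le> length ys"
    using assms(3,4)
  proof (induction ys arbitrary: u)
    case Nil
    then show ?case by (auto simp: awalk_Nil_iff intro: exI[of _ "[]"])
  next
    case (Cons y ys)
    from Cons.prems have y: "y \<in> S" "ys \<in> lists S" by auto
    have uy: "u \<triangleright> y \<in> C" using assms(1) Cons.prems(1) y(1) by (rule component_closed)
    from Cons.IH[OF uy y(2)] obtain p where
      p: "awalk (u \<triangleright> y) p (foldl (\<triangleright>) (u \<triangleright> y) ys)" "length p \<le> length ys" by blast
    show ?case
    proof (cases "u \<triangleright> y = u")
      case True
      with p show ?thesis by (intro exI[of _ p]) simp
    next
      case False
      then have "(y, u, u \<triangleright> y) \<in> arcs (G \<restriction> C)"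
        using y uy Cons.prems(1) assms(2) by (auto simp only: arcs_induced)
      with p show ?thesis
        by (intro exI[of _ "(y, u, u \<triangleright> y) # p"]) (simp add: awalk_Cons_iff)
    qed
  qed
  with that show ?thesis by blast
qed

lemma diameter_geodesic:
  assumes "spans_component G C" "C \<subseteq> X" "diameter (G \<restriction> C) = ereal (real d)"
  obtains u ys where "u \<in> C" "ys \<in> lists S" "geodesic u ys" "d \<le> length ys"
proof -
  interpret wf_digraph "G \<restriction> C" by (rule wf_induced)
  \<comment> \<open>Going strictly below the supremum yields a pair of vertices without showing that
    it is attained; integrality of lengths recovers \<open>d\<close> at the end. The subtraction is
    real, so \<open>d = 0\<close> is covered: the bound is then -1.\<close>
  have "ereal (real d - 1) < diameter (G \<restriction> C)" by (simp add: assms(3))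
  then obtain u v where uv: "u \<in> C" "v \<in> C" "ereal (real d - 1) < \<mu> (\<lambda>_. 1) u v"
    by (auto simp: diameter_def less_SUP_iff)
  have "u \<rightarrow>\<^sup>*\<^bsub>G \<restriction> C\<^esub> v"
    using assms(1) uv reachable_mk_symmetric_eq[OF symmetric_kei_graph[OF kei_axioms subset]]
    by (auto simp: spans_component_iff[OF wf_kei_graph] connected_def strongly_connected_def)
  then obtain zs where zs: "zs \<in> lists S" "foldl (\<triangleright>) u zs = v"
    by (metis reachable_awalk awalk_imp_word)
  then obtain ys where ys: "ys \<in> lists S" "foldl (\<triangleright>) u ys = v" "geodesic u ys"
    by (metis ex_geodesic)
  \<comment> \<open>The walk traced by the geodesic word bounds the distance from above, so the word
    has more than \<open>d - 1\<close> letters.\<close>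
  obtain p where p: "awalk u p v" "length p \<le> length ys"
    using word_imp_awalk[OF assms(1,2) uv(1) ys(1)] ys(2) by blast
  have "awalk_cost (\<lambda>_. 1) p = real (length p)"
    by (induction p) auto
  then have "\<mu> (\<lambda>_. 1) u v \<le> ereal (real (length p))"
    using min_cost_le_walk_cost[OF p(1), of "\<lambda>_. 1"] by simp
  with uv(3) have "ereal (real d - 1) < ereal (real (length p))" by (rule less_le_trans)
  then have "d \<le> length ys" using p(2) by simp
  with that uv(1) ys show ?thesis by blast
qed

section \<open>Counting vertices and edges\<close>

lemma card_component_ge:
  assumes "spans_component G C" "C \<subseteq> X" "finite C"
    and "u \<in> C" "ys \<in> lists S" "geodesic u ys"
  shows "2 ^ length ys \<le> card C"
proof -
  have "card (Pow {..<length ys}) \<le> card C"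
    using assms(1-5) inj_on_subword_endpoints[OF _ assms(5,6)]
    by (intro card_inj_on_le[of "\<lambda>A. foldl (\<triangleright>) u (nths ys A)"])
      (auto intro!: component_foldl_closed nths_lists)
  then show ?thesis by (simp add: card_Pow)
qed

lemma card_last_colour_ge:
  assumes "spans_component G C" "C \<subseteq> X" "finite (edges_of_colour (G \<restriction> C) k)"
    and "u \<in> C" "ys @ [k] \<in> lists S" "geodesic u (ys @ [k])"
  shows "2 ^ length ys \<le> card (edges_of_colour (G \<restriction> C) k)"
proof -
  let ?n = "length ys"
  let ?e = "\<lambda>A. foldl (\<triangleright>) u (nths ys A)"
  let ?e' = "\<lambda>A. foldl (\<triangleright>) u (nths (ys @ [k]) A)"
  from assms have k: "k \<in> S" "ys \<in> lists S" and uX: "u \<in> X" by auto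
  have inj: "inj_on ?e' (Pow {..<Suc ?n})"
    using inj_on_subword_endpoints[OF uX assms(5,6)] by simp
  have e: "?e A \<in> C" for A
    using assms k by (intro component_foldl_closed nths_lists)
  have e'1: "?e A = ?e' A" if "A \<subseteq> {..<?n}" for A
    using that by (auto simp: nths_snoc)
  have e'2: "?e A \<triangleright> k = ?e' (insert ?n A)" for A
    by (simp add: nths_snoc nths_insert_length)
  \<comment> \<open>This serves twice: with \<open>A = B\<close> it shows that the edges below are
    not loops, and in general it excludes the crossed case when two unordered pairs
    coincide.\<close>
  have ne: "?e A \<noteq> ?e B \<triangleright> k" if "A \<subseteq> {..<?n}" "B \<subseteq> {..<?n}" for A B
  proof
    assume "?e A = ?e B \<triangleright> k"
    then have "?e' A = ?e' (insert ?n B)"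
      using e'1[OF that(1)] e'2[of B] by simp
    then have "A = insert ?n B"
      using that by (intro inj_onD[OF inj]) auto
    with that show False by auto
  qed
  have "inj_on (\<lambda>A. {?e A, ?e A \<triangleright> k}) (Pow {..<?n})"
  proof (rule inj_onI)
    fix A B assume AB: "A \<in> Pow {..<?n}" "B \<in> Pow {..<?n}"
      and "{?e A, ?e A \<triangleright> k} = {?e B, ?e B \<triangleright> k}"
    then have "?e A = ?e B" using ne by (auto simp: doubleton_eq_iff)
    then show "A = B"
      using AB by (intro inj_onD[OF inj]) (auto simp: e'1 less_Suc_eq)
  qed
  moreover have "{?e A, ?e A \<triangleright> k} \<in> edges_of_colour (G \<restriction> C) k" if "A \<subseteq> {..<?n}" for A
  proof -
    have "?e A \<triangleright> k \<in> C" using assms(1) e k(1) by (rule component_closed)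
    then have "(k, ?e A, ?e A \<triangleright> k) \<in> arcs (G \<restriction> C)"
      using e k assms(2) ne[OF that that] by (auto simp only: arcs_induced)
    then show ?thesis unfolding edges_of_colour_def by blast
  qed
  ultimately have "card (Pow {..<?n}) \<le> card (edges_of_colour (G \<restriction> C) k)"
    using assms(3) by (intro card_inj_on_le) auto
  then show ?thesis by (simp add: card_Pow)
qed

end

theorem theorem1p4:
  fixes X S C :: "'a set" and oper :: "'a \<Rightarrow> 'a \<Rightarrow> 'a" and d :: nat
  assumes "kei X oper"
    and "subkei S X oper"
    and "C \<subseteq> X"
    and "spans_component (kei_graph X oper S) C"
    and "diameter (kei_graph X oper S \<restriction> C) = ereal (real d)"
  shows "(infinite C \<or> card C \<ge> 2 ^ d) \<and>
    (d \<ge> 1 \<longrightarrow>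
      (\<exists>k\<in>S. infinite (edges_of_colour (kei_graph X oper S \<restriction> C) k) \<or>
              card (edges_of_colour (kei_graph X oper S \<restriction> C) k) \<ge> 2 ^ (d - 1)))"
proof -
  interpret kei X oper by fact
  interpret kei_with_subkei X oper S
    using assms(2) by unfold_locales (auto simp: subkei_def kei.closed)
  obtain u ys where ys: "u \<in> C" "ys \<in> lists S" "geodesic u ys" "d \<le> length ys"
    using diameter_geodesic[OF assms(4,3,5)] .
  have "2 ^ d \<le> card C" if "finite C"
  proof -
    have "(2::nat) ^ d \<le> 2 ^ length ys" using ys(4) by (intro power_increasing) auto
    also have "\<dots> \<le> card C" using card_component_ge[OF assms(4,3) that ys(1-3)] .
    finally show ?thesis .
  qed
  moreover have "\<exists>k\<in>S. infinite (edges_of_colour (G \<restriction> C) k) \<or>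
      2 ^ (d - 1) \<le> card (edges_of_colour (G \<restriction> C) k)" if "d \<ge> 1"
  proof -
    \<comment> \<open>The colour is the last letter of the geodesic word, which is non-empty because
      \<open>d \<ge> 1\<close>; at least \<open>d - 1\<close> letters precede it.\<close>
    obtain zs k where zs: "ys = zs @ [k]"
      using ys(4) \<open>d \<ge> 1\<close> by (cases ys rule: rev_cases) auto
    have "2 ^ (d - 1) \<le> card (edges_of_colour (G \<restriction> C) k)"
      if "finite (edges_of_colour (G \<restriction> C) k)"
    proof -
      have "(2::nat) ^ (d - 1) \<le> 2 ^ length zs"
        using ys(4) zs by (intro power_increasing) auto
      also have "\<dots> \<le> card (edges_of_colour (G \<restriction> C) k)"
        using card_last_colour_ge[OF assms(4,3) that ys(1) ys(2,3)[unfolded zs]] .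
      finally show ?thesis .
    qed
    moreover have "k \<in> S" using ys(2) zs by simp
    ultimately show ?thesis by blast
  qed
  ultimately show ?thesis by blast
qed

end
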